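(* Let $l\ge2$ be an integer and let $$H=\left(\begin{array}{c} I_{l}\otimes\begin{pmatrix}1&0&1&1&1\\0&1&1&w&w^2\end{pmatrix}\\ \hline \mathbf 1_l\otimes\begin{pmatrix}0&0&1&w^2&w\end{pmatrix}\end{array}\right)$$ over $\mathbb F_4$. Then the linear code with parity-check matrix $H$ is an optimal quaternary $[n,k,d]$ $(r,\delta)$-LRC code with $n=5l$, $k=3l-1$, $d=4$, $r=3$, $\delta=3$.
   Context: $\mathbb F_4=\{0,1,w,w^2\}$ with $w^2=w+1$, $w^3=1$; $I_m$ is the $m\times m$ identity matrix, $\mathbf 1_l$ the all-ones row vector of length $l$, and $\otimes$ the Kronecker product. For a linear code $\mathcal C\subseteq\mathbb{F}_q^n$ and $R\subseteq[n]=\{1,\dots,n\}$, $\mathcal C|_R$ is the code obtained by puncturing (deleting) the coordinates outside $R$. An $[n,k,d]$ linear code $\mathcal C$ is an $(r,\delta)$-LRC code if for every $i\in[n]$ there is $R_i\subseteq[n]$ with $i\in R_i$, $|R_i|\le r+\delta-1$, such that $\mathcal C|_{R_i}$ has minimum distance at least $\delta$ (every nonzero word has weight at least $\delta$). Every such code satisfies $d\le n-k+1-(\lceil k/r\rceil-1)(\delta-1)$; it is $d$-optimal if equality holds. An $(r,\delta)$-LRC code is $r$-optimal if it is not an $(r',\delta)$-LRC code for any $1\le r'<r$. "Optimal $(r,\delta)$-LRC code" means an $(r,\delta)$-LRC code that is both $d$-optimal and $r$-optimal, with $d\ge\delta>2$ and $k>r\ge1$. *)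

theory Defs
  imports "Jordan_Normal_Form.Matrix_Kernel" "HOL-Library.Extended_Nat"
begin

text \<open>
  Words of length \<open>n\<close> are elements of \<open>carrier_vec n\<close>; coordinates are numbered \<open>0, \<dots>, n - 1\<close>
  instead of \<open>1, \<dots>, n\<close>.
\<close>

definition linear_code :: "nat \<Rightarrow> 'a::field vec set \<Rightarrow> bool" where
  "linear_code n C \<longleftrightarrow> VectorSpace.subspace class_ring C (module_vec TYPE('a) n)"

definition code_dim :: "nat \<Rightarrow> 'a::field vec set \<Rightarrow> nat" where
  "code_dim n C = vectorspace.dim class_ring ((module_vec TYPE('a) n)\<lparr>carrier := C\<rparr>)"

definition hamming_weight :: "'a::zero vec \<Rightarrow> nat" where
  "hamming_weight v = card {i. i < dim_vec v \<and> v $ i \<noteq> 0}"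

text \<open>
  The minimum distance of a linear code is the least weight of a nonzero word. It is \<open>\<infinity>\<close> for the
  zero code, so that \<open>enat \<delta> \<le> min_dist C\<close> says that every nonzero word has weight at least \<open>\<delta>\<close>.
\<close>

definition min_dist :: "'a::zero vec set \<Rightarrow> enat" where
  "min_dist C = (INF c\<in>{c \<in> C. c \<noteq> 0\<^sub>v (dim_vec c)}. enat (hamming_weight c))"

definition nkd_code :: "nat \<Rightarrow> nat \<Rightarrow> nat \<Rightarrow> 'a::field vec set \<Rightarrow> bool" where
  "nkd_code n k d C \<longleftrightarrow> linear_code n C \<and> code_dim n C = k \<and> min_dist C = enat d"

definition puncture_vec :: "'a vec \<Rightarrow> nat set \<Rightarrow> 'a vec" where
  "puncture_vec v R = vec_of_list (nths (list_of_vec v) R)"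

definition puncture :: "'a vec set \<Rightarrow> nat set \<Rightarrow> 'a vec set" where
  "puncture C R = (\<lambda>c. puncture_vec c R) ` C"

definition LRC :: "nat \<Rightarrow> nat \<Rightarrow> nat \<Rightarrow> 'a::field vec set \<Rightarrow> bool" where
  "LRC n r \<delta> C \<longleftrightarrow> linear_code n C \<and>
    (\<forall>i<n. \<exists>R \<subseteq> {..<n}. i \<in> R \<and> card R \<le> r + \<delta> - 1 \<and> enat \<delta> \<le> min_dist (puncture C R))"

definition d_optimal :: "nat \<Rightarrow> nat \<Rightarrow> nat \<Rightarrow> nat \<Rightarrow> nat \<Rightarrow> bool" where
  "d_optimal n k d r \<delta> \<longleftrightarrow>
    int d = int n - int k + 1 - (\<lceil>real k / real r\<rceil> - 1) * (int \<delta> - 1)"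

definition r_optimal :: "nat \<Rightarrow> nat \<Rightarrow> nat \<Rightarrow> 'a::field vec set \<Rightarrow> bool" where
  "r_optimal n r \<delta> C \<longleftrightarrow> (\<forall>r'. 1 \<le> r' \<and> r' < r \<longrightarrow> \<not> LRC n r' \<delta> C)"

definition optimal_LRC ::
    "nat \<Rightarrow> nat \<Rightarrow> nat \<Rightarrow> nat \<Rightarrow> nat \<Rightarrow> 'a::field vec set \<Rightarrow> bool" where
  "optimal_LRC n k d r \<delta> C \<longleftrightarrow>
    nkd_code n k d C \<and> LRC n r \<delta> C \<and> d_optimal n k d r \<delta> \<and> r_optimal n r \<delta> C \<and>
    d \<ge> \<delta> \<and> \<delta> > 2 \<and> k > r \<and> r \<ge> 1"

definition kronecker :: "'a::times mat \<Rightarrow> 'a mat \<Rightarrow> 'a mat" where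
  "kronecker A B = mat (dim_row A * dim_row B) (dim_col A * dim_col B)
    (\<lambda>(i, j). A $$ (i div dim_row B, j div dim_col B) * B $$ (i mod dim_row B, j mod dim_col B))"

definition parity_check :: "nat \<Rightarrow> 'a::field \<Rightarrow> 'a mat" where
  "parity_check l w =
    kronecker (1\<^sub>m l) (mat_of_rows_list 5 [[1, 0, 1, 1, 1], [0, 1, 1, w, w\<^sup>2]]) @\<^sub>r
    kronecker (mat 1 l (\<lambda>_. 1)) (mat_of_rows_list 5 [[0, 0, 1, w\<^sup>2, w]])"

end

theory Submission
  imports Defs
begin

text \<open>
  The two local checks of a block define a \<open>[5, 3, 3]\<close> code, which makes the blocks recovery sets,
  and together with the block's part of the last row a \<open>[5, 2, 4]\<close> code. A codeword supported in a
  single block lies in the latter and so has weight at least 4; any other nonzero codeword has weight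
  at least 3 in two blocks. The rows of the parity-check matrix are independent, so rank-nullity gives
  the dimension. No set \<open>R\<close> of at most four coordinates containing coordinate 0 is a recovery set for
  \<open>\<delta> = 3\<close>, because some codeword is nonzero at 0 and has weight at most 2 on \<open>R\<close>.
\<close>

section \<open>Hamming weights\<close>

lemma enat_le_min_dist_iff:
  "enat d \<le> min_dist C \<longleftrightarrow> (\<forall>c\<in>C. c \<noteq> 0\<^sub>v (dim_vec c) \<longrightarrow> d \<le> hamming_weight c)"
  by (auto simp: min_dist_def le_INF_iff)

lemma hamming_weight_eq_0_iff: "hamming_weight v = 0 \<longleftrightarrow> v = 0\<^sub>v (dim_vec v)"
  unfolding hamming_weight_def by (auto simp: vec_eq_iff)

text \<open>Puncturing renumbers the coordinates, so the entries are paired with their original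
  positions: \<open>nths\<close> is a filter on these pairs, and counting the surviving pairs brings
  back the numbering of \<open>v\<close>.\<close>

lemma hamming_weight_puncture:
  "hamming_weight (puncture_vec v R) = card {i. i \<in> R \<and> i < dim_vec v \<and> v $ i \<noteq> 0}"
proof -
  let ?xs = "list_of_vec v"
  have wt: "hamming_weight (vec_of_list ys) = length (filter (\<lambda>x. x \<noteq> 0) ys)" for ys :: "'a list"
    unfolding hamming_weight_def length_filter_conv_card by (simp add: vec_of_list_index)
  have "hamming_weight (puncture_vec v R)
      = length (filter (\<lambda>p. fst p \<noteq> 0 \<and> snd p \<in> R) (zip ?xs [0..<length ?xs]))"
    unfolding puncture_vec_def wt nths_def by (simp add: filter_map o_def conj_commute)
  also have "\<dots> = card {i. i \<in> R \<and> i < dim_vec v \<and> v $ i \<noteq> 0}"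
    unfolding length_filter_conv_card
    by (rule arg_cong[where f = card]) (auto simp: list_of_vec_index)
  finally show ?thesis .
qed

lemma sum_blocks:
  fixes f :: "nat \<Rightarrow> 'b::comm_monoid_add"
  shows "(\<Sum>i<m * k. f i) = (\<Sum>p<m. \<Sum>q<k. f (p * k + q))"
proof -
  have "(\<Sum>i = p * k..<p * k + k. f i) = (\<Sum>q<k. f (p * k + q))" for p
    using sum.shift_bounds_nat_ivl[of f 0 "p * k" k]
    by (simp add: add.commute lessThan_atLeast0)
  then show ?thesis
    by (simp flip: sum.nat_group)
qed

definition block_weight :: "'a::zero vec \<Rightarrow> nat \<Rightarrow> nat" where
  "block_weight v b = card {j. j < 5 \<and> v $ (b * 5 + j) \<noteq> 0}"

lemma hamming_weight_sum_blocks: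
  assumes "dim_vec v = 5 * l"
  shows "hamming_weight v = (\<Sum>b<l. block_weight v b)"
proof -
  have card_sum: "card {i. i < n \<and> P i} = (\<Sum>i<n. if P i then 1 else 0)"
    for n and P :: "nat \<Rightarrow> bool"
    by (simp add: sum.If_cases Int_def)
  have "hamming_weight v = (\<Sum>i<l * 5. if v $ i \<noteq> 0 then 1 else 0)"
    unfolding hamming_weight_def card_sum assms by (simp add: mult.commute)
  then show ?thesis
    unfolding sum_blocks block_weight_def card_sum .
qed

section \<open>Syndromes\<close>

lemma kronecker_carrier [simp]:
  "A \<in> carrier_mat m n \<Longrightarrow> B \<in> carrier_mat p q \<Longrightarrow> kronecker A B \<in> carrier_mat (m * p) (n * q)"
  by (auto simp: kronecker_def)

text \<open>Column \<open>a * q + b\<close> of the product meets block \<open>a\<close> of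
  \<open>v\<close>, so a row of \<open>B\<close> acts on each block separately and \<open>A\<close>
  only weights the results.\<close>

lemma kronecker_mult_vec_index:
  fixes A B :: "'a::comm_semiring_0 mat"
  assumes "A \<in> carrier_mat m n" "B \<in> carrier_mat p q" "v \<in> carrier_vec (n * q)" "i < m * p"
  shows "(kronecker A B *\<^sub>v v) $ i =
    (\<Sum>a<n. A $$ (i div p, a) * (\<Sum>b<q. B $$ (i mod p, b) * v $ (a * q + b)))"
proof -
  have "(kronecker A B *\<^sub>v v) $ i =
      (\<Sum>j<n * q. A $$ (i div p, j div q) * B $$ (i mod p, j mod q) * v $ j)"
    using assms by (simp add: kronecker_def scalar_prod_def lessThan_atLeast0)
  also have "\<dots> = (\<Sum>a<n. \<Sum>b<q. A $$ (i div p, a) * B $$ (i mod p, b) * v $ (a * q + b))"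
    unfolding sum_blocks by (intro sum.cong refl) auto
  finally show ?thesis
    by (simp add: sum_distrib_left mult.assoc)
qed

text \<open>\<open>check0\<close> and \<open>check1\<close> are the two local checks on block
  \<open>b\<close>; \<open>check2\<close> is the contribution of that block to the last row of the
  matrix.\<close>

definition check0 :: "'a::field vec \<Rightarrow> nat \<Rightarrow> 'a" where
  "check0 v b = v $ (b * 5) + v $ (b * 5 + 2) + v $ (b * 5 + 3) + v $ (b * 5 + 4)"

definition check1 :: "'a::field \<Rightarrow> 'a vec \<Rightarrow> nat \<Rightarrow> 'a" where
  "check1 w v b = v $ (b * 5 + 1) + v $ (b * 5 + 2) + w * v $ (b * 5 + 3) + w\<^sup>2 * v $ (b * 5 + 4)"

definition check2 :: "'a::field \<Rightarrow> 'a vec \<Rightarrow> nat \<Rightarrow> 'a" where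
  "check2 w v b = v $ (b * 5 + 2) + w\<^sup>2 * v $ (b * 5 + 3) + w * v $ (b * 5 + 4)"

lemma lessThan_5: "{..<5::nat} = {0, 1, 2, 3, 4}"
  by auto

lemma checks_vec:
  fixes f :: "nat \<Rightarrow> nat \<Rightarrow> 'a::field"
  assumes "b < l"
  defines "v \<equiv> vec (5 * l) (\<lambda>i. f (i div 5) (i mod 5))"
  shows "check0 v b = f b 0 + f b 2 + f b 3 + f b 4"
    and "check1 w v b = f b 1 + f b 2 + w * f b 3 + w\<^sup>2 * f b 4"
    and "check2 w v b = f b 2 + w\<^sup>2 * f b 3 + w * f b 4"
proof -
  have "v $ (b * 5 + j) = f b j" if "j < 5" for j
    using that \<open>b < l\<close> by (simp add: v_def)
  from this[of 0] this[of 1] this[of 2] this[of 3] this[of 4]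
  show "check0 v b = f b 0 + f b 2 + f b 3 + f b 4"
    "check1 w v b = f b 1 + f b 2 + w * f b 3 + w\<^sup>2 * f b 4"
    "check2 w v b = f b 2 + w\<^sup>2 * f b 3 + w * f b 4"
    by (simp_all add: check0_def check1_def check2_def)
qed

lemma parity_check_carrier [simp]: "parity_check l w \<in> carrier_mat (2 * l + 1) (5 * l)"
proof -
  have "parity_check l w \<in> carrier_mat (l * 2 + 1 * 1) (l * 5)"
    unfolding parity_check_def
    by (intro carrier_append_rows kronecker_carrier) (auto simp: mat_of_rows_list_def)
  then show ?thesis
    by (simp add: mult.commute)
qed

text \<open>The identity factor selects a single block, so rows \<open>2 * b\<close> and
  \<open>2 * b + 1\<close> hold the local checks of block \<open>b\<close>; the all-ones factor adds
  up all blocks in row \<open>2 * l\<close>.\<close>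

lemma parity_check_mult:
  assumes "v \<in> carrier_vec (5 * l)"
  shows "parity_check l w *\<^sub>v v = vec (2 * l + 1) (\<lambda>i.
    if i < 2 * l then if even i then check0 v (i div 2) else check1 w v (i div 2)
    else \<Sum>b<l. check2 w v b)"
proof -
  define B where "B = mat_of_rows_list 5 [[1, 0, 1, 1, 1], [0, 1, 1, w, w\<^sup>2]]"
  define D where "D = mat_of_rows_list 5 [[0, 0, 1, w\<^sup>2, w]]"
  have B: "B \<in> carrier_mat 2 5" and D: "D \<in> carrier_mat 1 5"
    by (auto simp: B_def D_def mat_of_rows_list_def)
  have v: "v \<in> carrier_vec (l * 5)"
    using assms by (simp add: mult.commute)
  have rowB: "(\<Sum>q<5. B $$ (t, q) * v $ (b * 5 + q)) = (if t = 0 then check0 v b else check1 w v b)"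
    if "t < 2" for t b
    using that unfolding lessThan_5
    by (auto simp: B_def mat_of_rows_list_def check0_def check1_def numeral_eq_Suc less_Suc_eq add_ac)
  have rowD: "(\<Sum>q<5. D $$ (0, q) * v $ (b * 5 + q)) = check2 w v b" for b
    unfolding lessThan_5
    by (simp add: D_def mat_of_rows_list_def check2_def numeral_eq_Suc add_ac)
  have upper: "(kronecker (1\<^sub>m l) B *\<^sub>v v) $ i =
      (if even i then check0 v (i div 2) else check1 w v (i div 2))" if i: "i < 2 * l" for i
  proof -
    have "(kronecker (1\<^sub>m l) B *\<^sub>v v) $ i =
        (\<Sum>a<l. 1\<^sub>m l $$ (i div 2, a) * (if i mod 2 = 0 then check0 v a else check1 w v a))"
      using i by (subst kronecker_mult_vec_index[OF one_carrier_mat B v]) (auto simp: rowB)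
    also have "\<dots> = (\<Sum>a<l. if a = i div 2
        then if i mod 2 = 0 then check0 v a else check1 w v a else 0)"
      using i by (intro sum.cong) auto
    finally show ?thesis
      using i by (auto simp: even_iff_mod_2_eq_zero)
  qed
  have lower: "(kronecker (mat 1 l (\<lambda>_. 1)) D *\<^sub>v v) $ 0 = (\<Sum>b<l. check2 w v b)"
    by (subst kronecker_mult_vec_index[OF mat_carrier D v]) (auto simp: rowD)
  have KB: "kronecker (1\<^sub>m l) B \<in> carrier_mat (l * 2) (l * 5)"
    and KD: "kronecker (mat 1 l (\<lambda>_. 1)) D \<in> carrier_mat (1 * 1) (l * 5)"
    by (rule kronecker_carrier[OF one_carrier_mat B], rule kronecker_carrier[OF mat_carrier D])
  have "parity_check l w *\<^sub>v v =
      (kronecker (1\<^sub>m l) B *\<^sub>v v) @\<^sub>v (kronecker (mat 1 l (\<lambda>_. 1)) D *\<^sub>v v)"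
    unfolding parity_check_def B_def[symmetric] D_def[symmetric]
    by (rule mat_mult_append[OF KB KD v])
  then show ?thesis
    using KB KD upper lower by (intro eq_vecI) (auto simp: mult.commute less_Suc_eq)
qed

lemma mem_kernel_parity_check_iff:
  "v \<in> mat_kernel (parity_check l w) \<longleftrightarrow> v \<in> carrier_vec (5 * l) \<and>
    (\<forall>b<l. check0 v b = 0 \<and> check1 w v b = 0) \<and> (\<Sum>b<l. check2 w v b) = 0"
proof (cases "v \<in> carrier_vec (5 * l)")
  case True
  have "parity_check l w *\<^sub>v v = 0\<^sub>v (2 * l + 1) \<longleftrightarrow>
      (\<forall>i<2 * l. (if even i then check0 v (i div 2) else check1 w v (i div 2)) = 0) \<and>
      (\<Sum>b<l. check2 w v b) = 0"
    unfolding parity_check_mult[OF True] by (auto simp: vec_eq_iff less_Suc_eq)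
  also have "(\<forall>i<2 * l. (if even i then check0 v (i div 2) else check1 w v (i div 2)) = 0) \<longleftrightarrow>
      (\<forall>b<l. check0 v b = 0 \<and> check1 w v b = 0)" (is "?L \<longleftrightarrow> ?R")
  proof
    assume L: ?L
    show ?R
    proof (intro allI impI)
      fix b assume "b < l"
      then show "check0 v b = 0 \<and> check1 w v b = 0"
        using L[rule_format, of "2 * b"] L[rule_format, of "2 * b + 1"] by auto
    qed
  next
    assume R: ?R
    show ?L
    proof (intro allI impI)
      fix i assume "i < 2 * l"
      then have "i div 2 < l"
        by linarith
      with R show "(if even i then check0 v (i div 2) else check1 w v (i div 2)) = 0"
        by simp
    qed
  qed
  finally show ?thesis
    using True by (simp add: mat_kernel[OF parity_check_carrier])
qed (simp add: mat_kernel[OF parity_check_carrier])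

section \<open>Dimension\<close>

lemma linear_code_mat_kernel:
  fixes A :: "'a::field mat"
  assumes "A \<in> carrier_mat m n"
  shows "linear_code n (mat_kernel A)"
proof -
  interpret vec_space "TYPE('a)" n .
  have "submodule class_ring (mat_kernel A) V"
  proof (rule submodule.intro)
    show "Module.module class_ring V"
      by (rule module_axioms)
  qed (use assms mult_add_distrib_mat_vec[OF assms] mult_mat_vec[OF assms]
      in \<open>auto simp: mat_kernel[OF assms]\<close>)
  then show ?thesis
    unfolding linear_code_def VectorSpace.subspace_def using vec_vs by blast
qed

text \<open>Rank-nullity for multiplication by \<open>A\<close>. Surjectivity stands for
  independence of the rows, in a form that is shown by exhibiting preimages.\<close>

lemma code_dim_mat_kernel_surj:
  fixes A :: "'a::field mat"
  assumes A: "A \<in> carrier_mat m n"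
    and surj: "\<And>y. y \<in> carrier_vec m \<Longrightarrow> \<exists>v\<in>carrier_vec n. A *\<^sub>v v = y"
  shows "code_dim n (mat_kernel A) + m = n"
proof -
  let ?V = "module_vec TYPE('a) n" and ?W = "module_vec TYPE('a) m" and ?f = "\<lambda>v. A *\<^sub>v v"
  note simps = module_vec_simps class_ring_simps
  have hom: "mod_hom class_ring ?V ?W ?f"
  proof (intro mod_hom.intro mod_hom_axioms.intro)
    show "?f \<in> LinearCombinations.module_hom class_ring ?V ?W"
      using A by (simp add: LinearCombinations.module_hom_def simps mult_add_distrib_mat_vec[OF A] mult_mat_vec[OF A])
  qed (use vec_vs in \<open>auto simp: vectorspace_def\<close>)
  then have lm: "linear_map class_ring ?V ?W ?f"
    by (intro linear_map.intro vec_vs)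
  have "mod_hom.ker ?V ?W ?f = mat_kernel A"
    using A by (simp add: mod_hom.ker_def[OF hom] mat_kernel simps)
  moreover have "mod_hom.im ?V ?f = carrier_vec m"
    using A surj by (auto simp: mod_hom.im_def[OF hom] image_def simps)
  \<comment> \<open>Rank-nullity speaks of the image as \<open>?W\<close> with its carrier replaced;
    as the image is everything, this is \<open>?W\<close> itself.\<close>
  moreover have "?W\<lparr>carrier := carrier_vec m\<rparr> = ?W"
    by (simp add: module_vec_def)
  ultimately show ?thesis
    using linear_map.rank_nullity[OF lm vec_space.fin_dim]
      vec_space.dim_is_n[where 'a = 'a and n = n] vec_space.dim_is_n[where 'a = 'a and n = m]
    by (simp add: code_dim_def)
qed

lemma code_dim_parity_check:
  fixes w :: "'a::field"
  assumes "l > 0"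
  shows "code_dim (5 * l) (mat_kernel (parity_check l w)) + (2 * l + 1) = 5 * l"
proof (rule code_dim_mat_kernel_surj[OF parity_check_carrier])
  fix y :: "'a vec" assume y: "y \<in> carrier_vec (2 * l + 1)"
  define t where "t = y $ (2 * l)"
  \<comment> \<open>Position 2 of block 0 carries the last syndrome entry \<open>t\<close>, which
    also enters both local checks of that block and is subtracted there. Positions 0 and 1 each
    occur in exactly one check, so they set the local syndromes freely.\<close>
  define f where "f b j = (if j = 0 then y $ (2 * b) - (if b = 0 then t else 0)
    else if j = 1 then y $ (2 * b + 1) - (if b = 0 then t else 0)
    else if j = 2 \<and> b = 0 then t else 0)" for b j :: nat
  define v where "v = vec (5 * l) (\<lambda>i. f (i div 5) (i mod 5))"
  have v: "v \<in> carrier_vec (5 * l)"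
    by (simp add: v_def)
  have "check0 v b = y $ (2 * b)" "check1 w v b = y $ (2 * b + 1)"
    "check2 w v b = (if b = 0 then t else 0)" if "b < l" for b
    unfolding v_def checks_vec[OF that] by (simp_all add: f_def)
  note checks = this
  have "parity_check l w *\<^sub>v v = y"
    unfolding parity_check_mult[OF v]
  proof (rule eq_vecI)
    fix i assume "i < dim_vec y"
    then show "vec (2 * l + 1) (\<lambda>i.
        if i < 2 * l then if even i then check0 v (i div 2) else check1 w v (i div 2)
        else \<Sum>b<l. check2 w v b) $ i = y $ i"
      using y checks \<open>l > 0\<close> by (auto simp: t_def less_Suc_eq)
  qed (use y in simp)
  with v show "\<exists>v\<in>carrier_vec (5 * l). parity_check l w *\<^sub>v v = y"
    by blast
qed

section \<open>The field with four elements\<close>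

text \<open>Translation by 1 permutes the field, so comparing the sums of all elements gives
  \<open>4 = 0\<close>; then \<open>2 = 0\<close>, because \<open>4 = 2 * 2\<close> and a field has
  no zero divisors.\<close>

lemma two_eq_0_if_card_4:
  assumes "card (UNIV :: 'a::field set) = 4"
  shows "(1::'a) + 1 = 0"
proof -
  have "(\<Sum>x\<in>UNIV. x + 1) = (\<Sum>x\<in>(UNIV :: 'a set). x)"
    by (rule sum.reindex_bij_witness[of _ "\<lambda>x. x - 1" "\<lambda>x. x + 1"]) auto
  then have "(of_nat 4 :: 'a) = 0"
    using assms by (simp add: sum.distrib)
  moreover have "(of_nat 4 :: 'a) = (1 + 1) * (1 + 1)"
    by simp
  ultimately show ?thesis
    by (metis mult_eq_0_iff)
qed

locale gf4 =
  fixes w :: "'a::field"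
  assumes card_4: "card (UNIV :: 'a set) = 4" and w_sq: "w\<^sup>2 = w + 1"
begin

lemma add_self [simp]: "x + x = (0::'a)"
  using two_eq_0_if_card_4[OF card_4] by (metis distrib_left mult.right_neutral mult_zero_right)

lemma add_self_left [simp]: "x + (x + y) = (y::'a)"
  by (simp flip: add.assoc)

lemma add_eq_0_iff_eq: "x + y = 0 \<longleftrightarrow> x = (y::'a)"
  by (metis add_self add_left_cancel)

lemma w_mult_self [simp]: "w * w = w + 1"
  using w_sq by (simp add: power2_eq_square)

lemma w_mult_self_left [simp]: "w * (w * x) = w * x + x"
  by (simp add: distrib_right flip: mult.assoc)

lemma w_neq [simp]: "w \<noteq> 0" "w \<noteq> 1" "1 \<noteq> w" "w + 1 \<noteq> 0" "1 + w \<noteq> 0"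
proof -
  show "w \<noteq> 0" "w \<noteq> 1"
    using w_mult_self by (auto simp del: w_mult_self)
  then show "1 \<noteq> w" "w + 1 \<noteq> 0" "1 + w \<noteq> 0"
    by (auto simp: add_eq_0_iff_eq)
qed

lemma gf4_cases: "x = 0 \<or> x = 1 \<or> x = w \<or> x = w + 1"
proof -
  have "finite (UNIV :: 'a set)"
    by (rule card_ge_0_finite) (simp add: card_4)
  moreover have "card {0, 1, w, w + 1} = card (UNIV :: 'a set)"
    using w_neq w_neq[symmetric] by (simp add: card_4)
  ultimately have "{0, 1, w, w + 1} = UNIV"
    by (intro card_subset_eq) auto
  then show ?thesis
    by blast
qed

section \<open>Weights of blocks and of codewords\<close>

lemma block_weight_eq:
  "block_weight v b = of_bool (v $ (b * 5) \<noteq> 0) + of_bool (v $ (b * 5 + 1) \<noteq> 0) +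
    of_bool (v $ (b * 5 + 2) \<noteq> 0) + of_bool (v $ (b * 5 + 3) \<noteq> 0) + of_bool (v $ (b * 5 + 4) \<noteq> 0)"
proof -
  have "{j. j < 5 \<and> v $ (b * 5 + j) \<noteq> 0} = {j \<in> {..<5}. v $ (b * 5 + j) \<noteq> 0}"
    by auto
  then have "block_weight v b = (\<Sum>j<5. of_bool (v $ (b * 5 + j) \<noteq> 0))"
    by (simp add: block_weight_def Int_def)
  then show ?thesis
    by (simp add: numeral_eq_Suc)
qed

text \<open>The local checks determine positions 0 and 1 from the other three, which leaves 64
  triples of field elements to evaluate. The bounds 3 and 4 are the distances of the
  \<open>[5, 3, 3]\<close> and \<open>[5, 2, 4]\<close> block codes.\<close>

lemma block_weight_ge:
  assumes "check0 v b = 0" "check1 w v b = 0" "block_weight v b \<noteq> 0"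
  shows "block_weight v b \<ge> (if check2 w v b = 0 then 4 else 3)"
proof -
  define x y z where "x = v $ (b * 5 + 2)" and "y = v $ (b * 5 + 3)" and "z = v $ (b * 5 + 4)"
  have c: "v $ (b * 5) = x + y + z" "v $ (b * 5 + 1) = x + w * y + w\<^sup>2 * z"
    using assms(1,2)
    by (simp_all add: check0_def check1_def add_eq_0_iff_eq add.assoc x_def y_def z_def)
  have "x = 0 \<and> y = 0 \<and> z = 0 \<or>
      of_bool (x + y + z \<noteq> 0) + of_bool (x + w * y + w\<^sup>2 * z \<noteq> 0) +
      of_bool (x \<noteq> 0) + of_bool (y \<noteq> 0) + of_bool (z \<noteq> 0) \<ge>
      (if x + w\<^sup>2 * y + w * z = 0 then 4 else 3 :: nat)"
    using gf4_cases[of x] gf4_cases[of y] gf4_cases[of z]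
    by (elim disjE) (simp_all add: w_sq algebra_simps)
  moreover have "block_weight v b = of_bool (x + y + z \<noteq> 0) + of_bool (x + w * y + w\<^sup>2 * z \<noteq> 0) +
      of_bool (x \<noteq> 0) + of_bool (y \<noteq> 0) + of_bool (z \<noteq> 0)"
    unfolding block_weight_eq c by (simp only: x_def y_def z_def)
  moreover have "check2 w v b = x + w\<^sup>2 * y + w * z"
    by (simp only: check2_def x_def y_def z_def)
  moreover have "\<not> (x = 0 \<and> y = 0 \<and> z = 0)"
    using calculation(2) assms(3) by auto
  ultimately show ?thesis
    by metis
qed

lemma hamming_weight_ge_4:
  assumes v: "v \<in> mat_kernel (parity_check l w)" and "v \<noteq> 0\<^sub>v (dim_vec v)"
  shows "4 \<le> hamming_weight v"
proof -
  have checks: "\<And>b. b < l \<Longrightarrow> check0 v b = 0 \<and> check1 w v b = 0"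
    and sum2: "(\<Sum>b<l. check2 w v b) = 0" and dim: "dim_vec v = 5 * l"
    using v by (auto simp: mem_kernel_parity_check_iff)
  have wt: "hamming_weight v = (\<Sum>b<l. block_weight v b)"
    by (rule hamming_weight_sum_blocks[OF dim])
  with assms(2) obtain b where b: "b < l" "block_weight v b \<noteq> 0"
    by (metis hamming_weight_eq_0_iff lessThan_iff sum.neutral)
  have split: "(\<Sum>b<l. f b) = f b + (\<Sum>a\<in>{..<l} - {b}. f a)" for f :: "nat \<Rightarrow> 'c::comm_monoid_add"
    using b by (simp add: sum.remove)
  show ?thesis
  proof (cases "\<exists>a<l. a \<noteq> b \<and> block_weight v a \<noteq> 0")
    case True
    then obtain a where a: "a < l" "a \<noteq> b" "block_weight v a \<noteq> 0"
      by blast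
    have "3 \<le> block_weight v a" "3 \<le> block_weight v b"
      using block_weight_ge[of v a] block_weight_ge[of v b] checks a b by (auto split: if_splits)
    moreover have "block_weight v a \<le> (\<Sum>a\<in>{..<l} - {b}. block_weight v a)"
      using a by (intro member_le_sum) auto
    ultimately show ?thesis
      unfolding wt split by linarith
  next
    case False
    \<comment> \<open>Weight 0 makes every entry of block \<open>a\<close> zero, so the last row
      reduces to the contribution of block \<open>b\<close>.\<close>
    have "check2 w v a = 0" if "a \<in> {..<l} - {b}" for a
      using that False by (auto simp: block_weight_eq check2_def)
    then have "check2 w v b = 0"
      using sum2 unfolding split by simp
    then show ?thesis
      using block_weight_ge[of v b] checks b unfolding wt split by auto
  qed
qed

section \<open>Words that repeat one block pattern, and the minimum distance\<close>

definition block_word :: "nat \<Rightarrow> nat set \<Rightarrow> 'a list \<Rightarrow> 'a vec" where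
  "block_word l S xs = vec (5 * l) (\<lambda>i. if i div 5 \<in> S then xs ! (i mod 5) else 0)"

text \<open>The last row sees the \<open>check2\<close> value of the pattern once per block of
  \<open>S\<close>, so it vanishes if the pattern passes on its own or if \<open>card S\<close> is
  zero in the field; both cases occur below.\<close>

lemma block_word_mem_kernel:
  assumes "S \<subseteq> {..<l}"
    and "xs ! 0 + xs ! 2 + xs ! 3 + xs ! 4 = 0"
    and "xs ! 1 + xs ! 2 + w * xs ! 3 + w\<^sup>2 * xs ! 4 = 0"
    and "of_nat (card S) * (xs ! 2 + w\<^sup>2 * xs ! 3 + w * xs ! 4) = 0"
  shows "block_word l S xs \<in> mat_kernel (parity_check l w)"
proof -
  let ?v = "block_word l S xs"
  have chk: "check0 ?v b = 0" "check1 w ?v b = 0"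
    "check2 w ?v b = (if b \<in> S then xs ! 2 + w\<^sup>2 * xs ! 3 + w * xs ! 4 else 0)" if "b < l" for b
    unfolding block_word_def checks_vec[OF that, where f = "\<lambda>b j. if b \<in> S then xs ! j else 0"]
    using assms(2,3) by simp_all
  have "(\<Sum>b<l. check2 w ?v b) = (\<Sum>b<l. if b \<in> S then xs ! 2 + w\<^sup>2 * xs ! 3 + w * xs ! 4 else 0)"
    by (intro sum.cong refl) (simp add: chk)
  also have "\<dots> = 0"
    using assms(1,4) by (simp add: sum.If_cases Int_absorb1)
  finally show ?thesis
    unfolding mem_kernel_parity_check_iff using chk by (simp add: block_word_def)
qed

lemma hamming_weight_puncture_block_word:
  assumes "R \<subseteq> {..<5 * l}"
  shows "hamming_weight (puncture_vec (block_word l S xs) R) =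
    card {i \<in> R. i div 5 \<in> S \<and> xs ! (i mod 5) \<noteq> 0}"
  unfolding hamming_weight_puncture
  by (rule arg_cong[where f = card]) (use assms in \<open>auto simp: block_word_def split: if_splits\<close>)

lemma min_dist_parity_check:
  assumes "l > 0"
  shows "min_dist (mat_kernel (parity_check l w)) = 4"
proof (rule antisym)
  \<comment> \<open>This pattern passes all three checks, as \<open>1 + w + w\<^sup>2 = 0\<close>,
    and attains the lower bound 4.\<close>
  let ?v = "block_word l {0} [1, 0, 1, 1, 1]"
  have v: "?v \<in> mat_kernel (parity_check l w)"
    using assms by (intro block_word_mem_kernel) (simp_all add: w_sq algebra_simps)
  have "{i. i < dim_vec ?v \<and> ?v $ i \<noteq> 0} = {i \<in> {..<5}. [1, 0, 1, 1, 1 :: 'a] ! i \<noteq> 0}"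
    using assms by (auto simp: block_word_def div_eq_0_iff split: if_splits)
  also have "\<dots> = {0, 2, 3, 4}"
    unfolding lessThan_5 by auto
  finally have wt: "hamming_weight ?v = 4"
    by (simp add: hamming_weight_def)
  then have "?v \<noteq> 0\<^sub>v (dim_vec ?v)"
    by (metis hamming_weight_eq_0_iff zero_neq_numeral)
  with v have "min_dist (mat_kernel (parity_check l w)) \<le> enat (hamming_weight ?v)"
    unfolding min_dist_def by (intro INF_lower) auto
  then show "min_dist (mat_kernel (parity_check l w)) \<le> 4"
    by (simp add: wt numeral_eq_enat)
next
  have "enat 4 \<le> min_dist (mat_kernel (parity_check l w))"
    unfolding enat_le_min_dist_iff by (blast intro: hamming_weight_ge_4)
  then show "4 \<le> min_dist (mat_kernel (parity_check l w))"
    by (simp add: numeral_eq_enat)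
qed

section \<open>Locality\<close>

lemma LRC_parity_check: "LRC (5 * l) 3 3 (mat_kernel (parity_check l w))"
  unfolding LRC_def
proof (intro conjI allI impI linear_code_mat_kernel[OF parity_check_carrier])
  fix i assume i: "i < 5 * l"
  define b where "b = i div 5"
  \<comment> \<open>The block of \<open>i\<close> has \<open>3 + 3 - 1\<close> coordinates, and the
    weight of a codeword punctured to it is its block weight, which the local checks force to be at
    least 3 unless it is zero.\<close>
  define R where "R = {b * 5..<b * 5 + 5}"
  have b: "b < l"
    using i by (simp add: b_def less_mult_imp_div_less mult.commute)
  have "3 \<le> hamming_weight (puncture_vec v R)"
    if v: "v \<in> mat_kernel (parity_check l w)"
      and nz: "puncture_vec v R \<noteq> 0\<^sub>v (dim_vec (puncture_vec v R))" for v
  proof -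
    have "{i. i \<in> R \<and> i < dim_vec v \<and> v $ i \<noteq> 0} = (\<lambda>j. b * 5 + j) ` {j. j < 5 \<and> v $ (b * 5 + j) \<noteq> 0}"
      (is "?L = ?R")
    proof (intro equalityI subsetI)
      fix i assume "i \<in> ?L"
      then show "i \<in> ?R"
        by (intro image_eqI[where x = "i - b * 5"]) (auto simp: R_def)
    qed (use v b in \<open>auto simp: R_def mem_kernel_parity_check_iff\<close>)
    then have "hamming_weight (puncture_vec v R) = block_weight v b"
      unfolding hamming_weight_puncture block_weight_def by (simp add: card_image)
    moreover from this have "block_weight v b \<noteq> 0"
      using nz by (metis hamming_weight_eq_0_iff)
    ultimately show ?thesis
      using v b block_weight_ge[of v b] by (auto simp: mem_kernel_parity_check_iff split: if_splits)
  qed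
  then have "enat 3 \<le> min_dist (puncture (mat_kernel (parity_check l w)) R)"
    unfolding enat_le_min_dist_iff puncture_def by blast
  moreover have "R \<subseteq> {..<5 * l}" "i \<in> R" "card R \<le> 3 + 3 - 1"
    using b by (auto simp: R_def b_def)
  ultimately show "\<exists>R\<subseteq>{..<5 * l}. i \<in> R \<and> card R \<le> 3 + 3 - 1 \<and>
      enat 3 \<le> min_dist (puncture (mat_kernel (parity_check l w)) R)"
    by blast
qed

text \<open>
  If \<open>R\<close> meets the first block in at most three
  coordinates, a word of weight 4 supported in that block and vanishing at a suitable coordinate of
  \<open>R\<close> has weight at most 2 on \<open>R\<close>. Otherwise \<open>R\<close> is the first block without one coordinate; then a
  word of the \<open>[5, 3, 3]\<close> code of weight 3 on the first block is repeated on the second block, so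
  that the last check is satisfied in characteristic 2.
\<close>

lemma low_weight_puncture:
  assumes l: "l \<ge> 2" and R: "R \<subseteq> {..<5 * l}" and "0 \<in> R" and card: "card R \<le> 4"
  obtains v where "v \<in> mat_kernel (parity_check l w)"
    "hamming_weight (puncture_vec v R) \<in> {1, 2}"
proof -
  note result = that
  have "finite R"
    using R finite_subset by blast
  \<comment> \<open>\<open>T\<close> only has to cover the support on \<open>R\<close>. Coordinate 0
    lies in \<open>R\<close> and carries a nonzero entry, so the punctured word is not zero.\<close>
  have *: thesis if "S \<subseteq> {..<l}" "0 \<in> S" "xs ! 0 \<noteq> 0"
    "xs ! 0 + xs ! 2 + xs ! 3 + xs ! 4 = 0"
    "xs ! 1 + xs ! 2 + w * xs ! 3 + w\<^sup>2 * xs ! 4 = 0"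
    "of_nat (card S) * (xs ! 2 + w\<^sup>2 * xs ! 3 + w * xs ! 4) = 0"
    "{i \<in> R. i div 5 \<in> S \<and> xs ! (i mod 5) \<noteq> 0} \<subseteq> T" "finite T" "card T \<le> 2" for S xs T
  proof (rule result[OF block_word_mem_kernel])
    let ?U = "{i \<in> R. i div 5 \<in> S \<and> xs ! (i mod 5) \<noteq> 0}"
    have "0 \<in> ?U"
      using that \<open>0 \<in> R\<close> by simp
    moreover have "finite ?U"
      using \<open>finite R\<close> by simp
    ultimately have "card ?U > 0"
      using card_gt_0_iff by blast
    moreover have "card ?U \<le> 2"
      using that card_mono[of T ?U] by linarith
    ultimately show "hamming_weight (puncture_vec (block_word l S xs) R) \<in> {1, 2}"
      unfolding hamming_weight_puncture_block_word[OF R] by auto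
  qed (use that in auto)
  show thesis
  proof (cases "card (R \<inter> {..<5}) \<le> 3")
    case True
    \<comment> \<open>Of the at most three coordinates of \<open>R\<close> in the first block, the
      zero at \<open>j\<close> removes one.\<close>
    have single: thesis if "j \<in> R" "j < 5" "xs ! 0 \<noteq> 0" "xs ! j = 0"
      "xs ! 0 + xs ! 2 + xs ! 3 + xs ! 4 = 0"
      "xs ! 1 + xs ! 2 + w * xs ! 3 + w\<^sup>2 * xs ! 4 = 0"
      "xs ! 2 + w\<^sup>2 * xs ! 3 + w * xs ! 4 = 0" for j xs
    proof (rule *[of "{0}" xs "R \<inter> {..<5} - {j}"])
      show "{i \<in> R. i div 5 \<in> {0} \<and> xs ! (i mod 5) \<noteq> 0} \<subseteq> R \<inter> {..<5} - {j}"
        using that by (auto simp: div_eq_0_iff)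
      show "card (R \<inter> {..<5} - {j}) \<le> 2"
        using that True \<open>finite R\<close> by (simp add: card_Diff_singleton)
    qed (use that l in auto)
    \<comment> \<open>Up to scaling, the \<open>[5, 2, 4]\<close> code has one nonzero word
      vanishing at a given position; it supplies the pattern for \<open>j\<close> equal to 1, 2 or
      3. If \<open>R\<close> contains none of these, it meets the block in at most 0 and 4, and any
      word of that code nonzero at 0 serves.\<close>
    consider "1 \<in> R" | "2 \<in> R" | "3 \<in> R" | "1 \<notin> R \<and> 2 \<notin> R \<and> 3 \<notin> R"
      by blast
    then show thesis
    proof cases
      case 1
      show thesis
        by (rule single[of 1 "[1, 0, 1, 1, 1]"]) (use 1 in \<open>simp_all add: w_sq algebra_simps\<close>)
    next
      case 2
      show thesis
        by (rule single[of 2 "[w + 1, w + 1, 0, 1, w]"])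
          (use 2 in \<open>simp_all add: w_sq algebra_simps\<close>)
    next
      case 3
      show thesis
        by (rule single[of 3 "[w + 1, 1, w, 0, 1]"])
          (use 3 in \<open>simp_all add: w_sq algebra_simps\<close>)
    next
      case 4
      have "i \<in> {0, 4}" if "i \<in> R" "i < 5" for i
      proof -
        have "i \<in> {..<5}"
          using that by simp
        with 4 that show ?thesis
          unfolding lessThan_5 by blast
      qed
      then show thesis
        by (intro *[of "{0}" "[1, 0, 1, 1, 1]" "{0, 4}"])
          (use l in \<open>auto simp: w_sq algebra_simps div_eq_0_iff\<close>)
    qed
  next
    case False
    \<comment> \<open>At least four elements of \<open>R\<close> lie in the first block, and
      \<open>R\<close> has at most four.\<close>
    then have "R \<inter> {..<5} = R"
      using \<open>finite R\<close> card by (intro card_seteq) auto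
    moreover have "R \<noteq> {..<5}"
      using card by auto
    ultimately obtain j where j: "j < 5" "j \<notin> R" and "R \<subseteq> {..<5}"
      by blast
    have less5: "i \<in> {0, 1, 2, 3, 4} - {j} \<and> i div 5 = 0 \<and> i mod 5 = i" if "i \<in> R" for i
    proof -
      have "i \<in> {..<5}" "i \<noteq> j"
        using that j \<open>R \<subseteq> {..<5}\<close> by blast+
      moreover from this(1) have "i div 5 = 0" "i mod 5 = i"
        by simp_all
      ultimately show ?thesis
        unfolding lessThan_5 by blast
    qed
    \<comment> \<open>The second copy sits in a block that \<open>R\<close> does not meet, so it
      repairs the last check without adding weight on \<open>R\<close>.\<close>
    have double: thesis if "xs ! 0 \<noteq> 0"
      "xs ! 0 + xs ! 2 + xs ! 3 + xs ! 4 = 0"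
      "xs ! 1 + xs ! 2 + w * xs ! 3 + w\<^sup>2 * xs ! 4 = 0"
      "{i \<in> {0, 1, 2, 3, 4} - {j}. xs ! i \<noteq> 0} \<subseteq> T" "finite T" "card T \<le> 2" for xs T
    proof (rule *[of "{0, 1}" xs T])
      show "{i \<in> R. i div 5 \<in> {0, 1} \<and> xs ! (i mod 5) \<noteq> 0} \<subseteq> T"
      proof
        fix i assume "i \<in> {i \<in> R. i div 5 \<in> {0, 1} \<and> xs ! (i mod 5) \<noteq> 0}"
        then have "i \<in> {i \<in> {0, 1, 2, 3, 4} - {j}. xs ! i \<noteq> 0}"
          using less5[of i] by simp
        with that(4) show "i \<in> T"
          by blast
      qed
      have "(2::'a) = 0"
        using add_self[of 1] unfolding one_add_one .
      then show "of_nat (card {0, 1::nat}) * (xs ! 2 + w\<^sup>2 * xs ! 3 + w * xs ! 4) = 0"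
        by simp
    qed (use that l in auto)
    have "j \<noteq> 0"
      using j \<open>0 \<in> R\<close> by metis
    \<comment> \<open>Each pattern has support \<open>{0, 1, k}\<close> with \<open>k\<close> among
      2, 3, 4, the entry at 1 being forced by the second local check. A support containing the
      missing \<open>j\<close> leaves at most two nonzero entries on \<open>R\<close>.\<close>
    then consider "j = 1" | "j = 2" | "j = 3" | "j = 4"
      using j by linarith
    then show thesis
    proof cases
      case 1
      then show thesis
        by (intro double[of "[1, 1, 1, 0, 0]" "{0, 2}"]) auto
    next
      case 2
      then show thesis
        by (intro double[of "[1, 1, 1, 0, 0]" "{0, 1}"]) auto
    next
      case 3
      then show thesis
        by (intro double[of "[1, w, 0, 1, 0]" "{0, 1}"]) auto
    next
      case 4
      then show thesis
        by (intro double[of "[1, w\<^sup>2, 0, 0, 1]" "{0, 1}"]) auto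
    qed
  qed
qed

end

theorem mainTheorem9:
  fixes w :: "'a::field" and l :: nat
  assumes "card (UNIV :: 'a set) = 4" and "w\<^sup>2 = w + 1" and "l \<ge> 2"
  shows "optimal_LRC (5 * l) (3 * l - 1) 4 3 3 (mat_kernel (parity_check l w))"
proof -
  interpret gf4 w
    by standard (fact assms)+
  let ?C = "mat_kernel (parity_check l w)"
  have "nkd_code (5 * l) (3 * l - 1) 4 ?C"
    using linear_code_mat_kernel[OF parity_check_carrier[of l w]] code_dim_parity_check[of l w]
      min_dist_parity_check[of l] \<open>l \<ge> 2\<close>
    by (simp add: nkd_code_def numeral_eq_enat)
  moreover have "d_optimal (5 * l) (3 * l - 1) 4 3 3"
  proof -
    \<comment> \<open>The quotient is \<open>l - 1/3\<close>, so the bound evaluates to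
      \<open>5 * l - (3 * l - 1) + 1 - 2 * (l - 1) = 4\<close>.\<close>
    have "\<lceil>real (3 * l - 1) / real 3\<rceil> = int l"
      using \<open>l \<ge> 2\<close> by (intro ceiling_unique) (auto simp: of_nat_diff field_simps)
    then show ?thesis
      using \<open>l \<ge> 2\<close> by (simp add: d_optimal_def of_nat_diff)
  qed
  moreover have "r_optimal (5 * l) 3 3 ?C"
    unfolding r_optimal_def
  proof (intro allI impI notI)
    fix r' assume r': "1 \<le> r' \<and> r' < (3::nat)" and LRC: "LRC (5 * l) r' 3 ?C"
    then obtain R where R: "R \<subseteq> {..<5 * l}" "0 \<in> R" "card R \<le> r' + 3 - 1"
      "enat 3 \<le> min_dist (puncture ?C R)"
      using \<open>l \<ge> 2\<close> unfolding LRC_def by force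
    \<comment> \<open>The recovery set of coordinate 0 alone gives the contradiction: it has at most
      \<open>r' + 2\<close> elements, and \<open>r' \<le> 2\<close>.\<close>
    have "card R \<le> 4"
      using R(3) r' by linarith
    then obtain v where v: "v \<in> ?C" and wt: "hamming_weight (puncture_vec v R) \<in> {1, 2}"
      using low_weight_puncture[OF \<open>l \<ge> 2\<close> R(1,2)] by metis
    from wt have "puncture_vec v R \<noteq> 0\<^sub>v (dim_vec (puncture_vec v R))"
      by (auto simp flip: hamming_weight_eq_0_iff)
    with R(4) v have "3 \<le> hamming_weight (puncture_vec v R)"
      unfolding enat_le_min_dist_iff puncture_def by blast
    with wt show False
      by auto
  qed
  ultimately show ?thesis
    using LRC_parity_check \<open>l \<ge> 2\<close> by (simp add: optimal_LRC_def)
qed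

end
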